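(* Let $n\ge 2$ and let $G$ be the Cayley graph of the symmetric group $S_n$ with all transpositions as generators (vertex set $S_n$, $x\sim \tau x$ for every transposition $\tau$). Then $\mathrm{Ric}(G)=2$.
   Context: For a graph $G=(V,E)$ (undirected, simple, locally finite, no isolated vertices; $y\sim x$ means adjacency) and $f,g:V\to\mathbb R$ define $\Delta f(x)=\sum_{y\sim x}(f(y)-f(x))$, $\Gamma(f,g)(x)=\frac12\sum_{y\sim x}(f(x)-f(y))(g(x)-g(y))$, $\Gamma(f)=\Gamma(f,f)$, $\Gamma_2(f)=\frac12\Delta\Gamma(f)-\Gamma(f,\Delta f)$. The curvature $\mathrm{Ric}(G)$ is the largest $K\in\mathbb R$ such that $\Gamma_2(f)(x)\ge K\,\Gamma(f)(x)$ for all $f:V\to\mathbb R$ and all $x\in V$. *)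

theory Defs
  imports Complex_Main "HOL-Algebra.Sym_Groups"
begin

locale lf_graph =
  fixes V :: "'a set" and adj :: "'a \<Rightarrow> 'a \<Rightarrow> bool"
  assumes adj_sym: "\<lbrakk>x \<in> V; y \<in> V; adj x y\<rbrakk> \<Longrightarrow> adj y x"
    and adj_irrefl: "x \<in> V \<Longrightarrow> \<not> adj x x"
    and locally_finite: "x \<in> V \<Longrightarrow> finite {y \<in> V. adj x y}"
    and no_isolated: "x \<in> V \<Longrightarrow> \<exists>y\<in>V. adj x y"

text \<open>
  Functions on the vertex set are represented by functions on the whole type; for a vertex
  \<open>x\<close> the operators below read their values on \<open>V\<close> only.
\<close>

definition laplacian ::
  "'a set \<Rightarrow> ('a \<Rightarrow> 'a \<Rightarrow> bool) \<Rightarrow> ('a \<Rightarrow> real) \<Rightarrow> 'a \<Rightarrow> real" where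
  "laplacian V adj f x = (\<Sum>y\<in>{y \<in> V. adj x y}. f y - f x)"

definition Gam ::
  "'a set \<Rightarrow> ('a \<Rightarrow> 'a \<Rightarrow> bool) \<Rightarrow> ('a \<Rightarrow> real) \<Rightarrow> ('a \<Rightarrow> real) \<Rightarrow> 'a \<Rightarrow> real" where
  "Gam V adj f g x = 1/2 * (\<Sum>y\<in>{y \<in> V. adj x y}. (f x - f y) * (g x - g y))"

definition Gam2 ::
  "'a set \<Rightarrow> ('a \<Rightarrow> 'a \<Rightarrow> bool) \<Rightarrow> ('a \<Rightarrow> real) \<Rightarrow> 'a \<Rightarrow> real" where
  "Gam2 V adj f x =
     1/2 * laplacian V adj (Gam V adj f f) x - Gam V adj f (laplacian V adj f) x"

definition curvature_bound :: "'a set \<Rightarrow> ('a \<Rightarrow> 'a \<Rightarrow> bool) \<Rightarrow> real \<Rightarrow> bool" where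
  "curvature_bound V adj K \<longleftrightarrow>
     (\<forall>f :: 'a \<Rightarrow> real. \<forall>x\<in>V. Gam2 V adj f x \<ge> K * Gam V adj f f x)"

definition has_Ric :: "'a set \<Rightarrow> ('a \<Rightarrow> 'a \<Rightarrow> bool) \<Rightarrow> real \<Rightarrow> bool" where
  "has_Ric V adj K \<longleftrightarrow>
     curvature_bound V adj K \<and> (\<forall>K'. curvature_bound V adj K' \<longrightarrow> K' \<le> K)"

text \<open>Only meaningful when a largest curvature bound exists.\<close>

definition Ric :: "'a set \<Rightarrow> ('a \<Rightarrow> 'a \<Rightarrow> bool) \<Rightarrow> real" where
  "Ric V adj = (THE K. has_Ric V adj K)"

lemma has_Ric_imp_Ric_eq: "has_Ric V adj K \<Longrightarrow> Ric V adj = K"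
  unfolding Ric_def by (rule the_equality) (auto simp: has_Ric_def intro: antisym)

definition cayley_adj :: "('a, 'b) monoid_scheme \<Rightarrow> 'a set \<Rightarrow> 'a \<Rightarrow> 'a \<Rightarrow> bool" where
  "cayley_adj G S x y \<longleftrightarrow> (\<exists>s\<in>S. y = s \<otimes>\<^bsub>G\<^esub> x)"

definition transpositions :: "nat \<Rightarrow> (nat \<Rightarrow> nat) set" where
  "transpositions n = {transpose a b | a b. a \<in> {1..n} \<and> b \<in> {1..n} \<and> a \<noteq> b}"

lemma lf_graph_transpositions:
  assumes "n \<ge> 2"
  shows "lf_graph (carrier (sym_group n)) (cayley_adj (sym_group n) (transpositions n))"
proof
  fix x y assume "cayley_adj (sym_group n) (transpositions n) x y"
  then obtain a b where ab: "a \<in> {1..n}" "b \<in> {1..n}" "a \<noteq> b" "y = transpose a b \<circ> x"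
    by (auto simp: cayley_adj_def transpositions_def sym_group_def)
  then have "x = transpose a b \<circ> y" by (auto simp: fun_eq_iff)
  with ab show "cayley_adj (sym_group n) (transpositions n) y x"
    by (auto simp: cayley_adj_def transpositions_def sym_group_def)
next
  fix x assume "x \<in> carrier (sym_group n)"
  then have x: "x permutes {1..n}" by (simp add: sym_group_def)
  show "\<not> cayley_adj (sym_group n) (transpositions n) x x"
  proof
    assume "cayley_adj (sym_group n) (transpositions n) x x"
    then obtain a b where ab: "a \<noteq> b" "x = transpose a b \<circ> x"
      by (auto simp: cayley_adj_def transpositions_def sym_group_def)
    obtain c where c: "x c = a" using permutes_surj[OF x] by (metis surjD)
    have "x c = transpose a b (x c)" using ab(2) by (metis comp_apply)
    with c ab(1) show False by simp
  qed
  show "finite {y \<in> carrier (sym_group n). cayley_adj (sym_group n) (transpositions n) x y}"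
    by (simp add: sym_group_def finite_permutations)
  have "transpose 1 2 \<circ> x permutes {1..n}"
    using x assms by (intro permutes_compose permutes_swap_id) auto
  moreover have "transpose 1 2 \<in> transpositions n"
    using assms unfolding transpositions_def by (intro CollectI exI[of _ 1] exI[of _ 2]) auto
  ultimately show "\<exists>y\<in>carrier (sym_group n). cayley_adj (sym_group n) (transpositions n) x y"
    by (auto simp: cayley_adj_def sym_group_def)
qed

end

theory Submission imports Defs begin

text \<open>
  Let \<open>S\<close> be a finite conjugation-invariant set of involutions of a group, and at a vertex \<open>x\<close>
  put \<open>w s t = f (s t x) - f (s x) - f (t x) + f x\<close>. Expanding \<open>\<Gamma>\<^sub>2\<close> gives
  \<open>4 \<Gamma>\<^sub>2(f)(x) = (\<Sum>s t. (w s t)\<^sup>2) + 2 * (\<Sum>s t. w s t * (f (t x) - f (s x)))\<close>. The second sum vanishes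
  because \<open>(s, t) \<mapsto> (t, t s t)\<close> permutes the pairs in \<open>S \<times> S\<close> and preserves the product \<open>s t\<close>. The
  diagonal terms \<open>w s s = -2 * (f (s x) - f x)\<close> of the first sum already add up to \<open>8 \<Gamma>(f)(x)\<close>, so
  the curvature is at least 2. Equality holds at the identity for the function with
  values 0 at the identity, 1 on \<open>S\<close> and 2 elsewhere, provided no product of two elements
  of \<open>S\<close> lies in \<open>S\<close>; for transpositions this is parity.
\<close>

text \<open>Conjugators come from \<open>S\<close> only; as \<open>t\<close> is its own inverse,
  conjugation takes the form \<open>t \<otimes> s \<otimes> t\<close>.\<close>

locale involution_cayley = group G for G (structure) +
  fixes S :: "'a set"
  assumes S_finite: "finite S"
    and S_carrier: "s \<in> S \<Longrightarrow> s \<in> carrier G"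
    and S_involution: "s \<in> S \<Longrightarrow> s \<otimes> s = \<one>"
    and S_conj: "\<lbrakk>s \<in> S; t \<in> S\<rbrakk> \<Longrightarrow> t \<otimes> s \<otimes> t \<in> S"
begin

lemma S_cancel: "\<lbrakk>s \<in> S; x \<in> carrier G\<rbrakk> \<Longrightarrow> s \<otimes> (s \<otimes> x) = x"
  by (simp add: S_carrier S_involution m_assoc[symmetric])

lemma S_conj_conj: "\<lbrakk>s \<in> S; t \<in> S\<rbrakk> \<Longrightarrow> t \<otimes> (t \<otimes> s \<otimes> t) \<otimes> t = s"
  by (simp add: S_carrier S_involution S_cancel m_assoc)

text \<open>Right cancellation makes \<open>s \<otimes> x\<close> distinct for distinct
  \<open>s\<close>, so every neighbourhood can be indexed by the same set \<open>S\<close>.\<close>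

lemma sum_neighbours:
  assumes "x \<in> carrier G"
  shows "(\<Sum>y\<in>{y \<in> carrier G. cayley_adj G S x y}. h y) = (\<Sum>s\<in>S. h (s \<otimes> x))"
proof -
  have "{y \<in> carrier G. cayley_adj G S x y} = (\<lambda>s. s \<otimes> x) ` S"
    using assms by (auto simp: cayley_adj_def S_carrier)
  moreover have "inj_on (\<lambda>s. s \<otimes> x) S"
    using assms by (auto intro!: inj_onI simp: S_carrier)
  ultimately show ?thesis by (simp add: sum.reindex)
qed

lemma laplacian_cayley:
  "x \<in> carrier G \<Longrightarrow>
    laplacian (carrier G) (cayley_adj G S) f x = (\<Sum>s\<in>S. f (s \<otimes> x) - f x)"
  by (simp add: laplacian_def sum_neighbours)

lemma Gam_cayley:
  "x \<in> carrier G \<Longrightarrow>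
    Gam (carrier G) (cayley_adj G S) f g x
      = 1/2 * (\<Sum>s\<in>S. (f x - f (s \<otimes> x)) * (g x - g (s \<otimes> x)))"
  by (simp add: Gam_def sum_neighbours)

lemma sum_conj:
  assumes "s \<in> S"
  shows "(\<Sum>t\<in>S. h (s \<otimes> t \<otimes> s)) = (\<Sum>t\<in>S. h t)"
  by (rule sum.reindex_bij_witness[where i = "\<lambda>t. s \<otimes> t \<otimes> s" and j = "\<lambda>t. s \<otimes> t \<otimes> s"])
    (auto simp: assms S_conj S_conj_conj)

text \<open>For fixed \<open>s\<close>, replace \<open>t\<close> by its conjugate
  \<open>s \<otimes> t \<otimes> s\<close>: its last factor cancels against the \<open>s\<close> in
  front of \<open>x\<close>.\<close>

lemma sum_mult_commute:
  assumes x: "x \<in> carrier G" and s: "s \<in> S"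
  shows "(\<Sum>t\<in>S. h (t \<otimes> (s \<otimes> x))) = (\<Sum>t\<in>S. h (s \<otimes> (t \<otimes> x)))"
proof -
  have "(\<Sum>t\<in>S. h (t \<otimes> (s \<otimes> x))) = (\<Sum>t\<in>S. h ((s \<otimes> t \<otimes> s) \<otimes> (s \<otimes> x)))"
    by (rule sum_conj[OF s, of "\<lambda>t. h (t \<otimes> (s \<otimes> x))", symmetric])
  also have "\<dots> = (\<Sum>t\<in>S. h (s \<otimes> (t \<otimes> x)))"
    using x s by (intro sum.cong) (simp_all add: S_carrier S_cancel m_assoc)
  finally show ?thesis .
qed

text \<open>The weight \<open>a s\<close> is constant in the inner sum, so the two factors can be
  commuted there; exchanging the names \<open>s\<close> and \<open>t\<close> then moves the weight
  to \<open>t\<close>.\<close>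

lemma sum_product_weight_swap:
  fixes h a :: "'a \<Rightarrow> real"
  assumes x: "x \<in> carrier G"
  shows "(\<Sum>s\<in>S. \<Sum>t\<in>S. h (s \<otimes> (t \<otimes> x)) * a s) = (\<Sum>s\<in>S. \<Sum>t\<in>S. h (s \<otimes> (t \<otimes> x)) * a t)"
proof -
  have "(\<Sum>s\<in>S. \<Sum>t\<in>S. h (s \<otimes> (t \<otimes> x)) * a s) = (\<Sum>s\<in>S. (\<Sum>t\<in>S. h (t \<otimes> (s \<otimes> x))) * a s)"
    by (intro sum.cong) (simp_all add: sum_mult_commute[OF x, of _ h] sum_distrib_right)
  also have "\<dots> = (\<Sum>s\<in>S. \<Sum>t\<in>S. h (t \<otimes> (s \<otimes> x)) * a s)"
    by (simp add: sum_distrib_right)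
  also have "\<dots> = (\<Sum>s\<in>S. \<Sum>t\<in>S. h (s \<otimes> (t \<otimes> x)) * a t)"
    by (rule sum.swap)
  finally show ?thesis .
qed

lemma Gam2_cayley:
  assumes x: "x \<in> carrier G"
  shows "Gam2 (carrier G) (cayley_adj G S) f x
    = 1/4 * (\<Sum>s\<in>S. \<Sum>t\<in>S. (f (s \<otimes> (t \<otimes> x)) - f (s \<otimes> x) - f (t \<otimes> x) + f x)\<^sup>2)"
proof -
  define a where "a s = f (s \<otimes> x) - f x" for s
  define w where "w s t = f (s \<otimes> (t \<otimes> x)) - f (s \<otimes> x) - f (t \<otimes> x) + f x" for s t
  define W where "W = (\<Sum>s\<in>S. \<Sum>t\<in>S. (w s t)\<^sup>2)"
  have sx: "s \<otimes> x \<in> carrier G" if "s \<in> S" for s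
    using that x by (simp add: S_carrier)
  have "4 * Gam2 (carrier G) (cayley_adj G S) f x =
    (\<Sum>s\<in>S. (\<Sum>t\<in>S. (f (s \<otimes> x) - f (t \<otimes> (s \<otimes> x)))\<^sup>2) - (\<Sum>t\<in>S. (a t)\<^sup>2))
    - 2 * (\<Sum>s\<in>S. a s * ((\<Sum>t\<in>S. f (t \<otimes> (s \<otimes> x)) - f (s \<otimes> x)) - (\<Sum>t\<in>S. a t)))"
  proof -
    have "(f x - f (s \<otimes> x)) * (laplacian (carrier G) (cayley_adj G S) f x
          - laplacian (carrier G) (cayley_adj G S) f (s \<otimes> x))
      = a s * ((\<Sum>t\<in>S. f (t \<otimes> (s \<otimes> x)) - f (s \<otimes> x)) - (\<Sum>t\<in>S. a t))" if "s \<in> S" for s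
      unfolding laplacian_cayley[OF x] laplacian_cayley[OF sx[OF that]] a_def
      by (simp only: algebra_simps)
    moreover have "4 * (1/2 * (Gam (carrier G) (cayley_adj G S) f f (s \<otimes> x)
          - Gam (carrier G) (cayley_adj G S) f f x))
      = (\<Sum>t\<in>S. (f (s \<otimes> x) - f (t \<otimes> (s \<otimes> x)))\<^sup>2) - (\<Sum>t\<in>S. (a t)\<^sup>2)" if "s \<in> S" for s
      unfolding Gam_cayley[OF x] Gam_cayley[OF sx[OF that]] a_def
      by (simp add: power2_eq_square[symmetric] power2_commute[of "f x"])
    ultimately show ?thesis
      unfolding Gam2_def laplacian_cayley[OF x, of "Gam (carrier G) (cayley_adj G S) f f"]
        Gam_cayley[OF x, of f "laplacian (carrier G) (cayley_adj G S) f"]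
      by (simp add: right_diff_distrib sum_distrib_left)
  qed
  \<comment> \<open>Commuting \<open>s\<close> and \<open>t\<close> inside each inner sum brings in
    \<open>s \<otimes> (t \<otimes> x)\<close>, the vertex that occurs in
    \<open>w s t\<close>.\<close>
  also have "\<dots> = (\<Sum>s\<in>S. (\<Sum>t\<in>S. (f (s \<otimes> x) - f (s \<otimes> (t \<otimes> x)))\<^sup>2) - (\<Sum>t\<in>S. (a t)\<^sup>2))
    - 2 * (\<Sum>s\<in>S. a s * ((\<Sum>t\<in>S. f (s \<otimes> (t \<otimes> x)) - f (s \<otimes> x)) - (\<Sum>t\<in>S. a t)))"
  proof -
    have "(\<Sum>t\<in>S. (f (s \<otimes> x) - f (t \<otimes> (s \<otimes> x)))\<^sup>2) = (\<Sum>t\<in>S. (f (s \<otimes> x) - f (s \<otimes> (t \<otimes> x)))\<^sup>2)"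
      and "(\<Sum>t\<in>S. f (t \<otimes> (s \<otimes> x)) - f (s \<otimes> x)) = (\<Sum>t\<in>S. f (s \<otimes> (t \<otimes> x)) - f (s \<otimes> x))"
      if "s \<in> S" for s
      using sum_mult_commute[OF x that, of "\<lambda>y. (f (s \<otimes> x) - f y)\<^sup>2"]
        sum_mult_commute[OF x that, of "\<lambda>y. f y - f (s \<otimes> x)"] by simp_all
    then show ?thesis by simp
  qed
  also have "\<dots> = (\<Sum>s\<in>S. \<Sum>t\<in>S. (f (s \<otimes> x) - f (s \<otimes> (t \<otimes> x)))\<^sup>2 - (a t)\<^sup>2
      - 2 * (a s * (f (s \<otimes> (t \<otimes> x)) - f (s \<otimes> x) - a t)))"
    by (simp add: sum_subtractf sum_distrib_left right_diff_distrib mult_ac)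
  \<comment> \<open>Completing the square leaves three differences. The double sum of each is zero:
    the last two by exchanging \<open>s\<close> and \<open>t\<close>, the first by the weight
    swap.\<close>
  also have "\<dots> = (\<Sum>s\<in>S. \<Sum>t\<in>S. (w s t)\<^sup>2
      + 2 * (f (s \<otimes> (t \<otimes> x)) * a t - f (s \<otimes> (t \<otimes> x)) * a s)
      + 2 * (f x * a s - f x * a t) + 2 * ((a s)\<^sup>2 - (a t)\<^sup>2))"
    by (intro sum.cong refl) (simp add: w_def a_def power2_eq_square algebra_simps)
  also have "\<dots> = W"
    using sum_product_weight_swap[OF x, of f a] sum.swap[of "\<lambda>s t. f x * a s" S S]
      sum.swap[of "\<lambda>s t. (a s)\<^sup>2" S S]
    by (simp add: W_def sum.distrib sum_subtractf sum_distrib_left[symmetric])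
  finally show ?thesis by (simp add: W_def w_def)
qed

lemma curvature_bound_2: "curvature_bound (carrier G) (cayley_adj G S) 2"
  unfolding curvature_bound_def
proof (intro allI ballI)
  fix f :: "'a \<Rightarrow> real" and x assume x: "x \<in> carrier G"
  define w where "w s t = f (s \<otimes> (t \<otimes> x)) - f (s \<otimes> x) - f (t \<otimes> x) + f x" for s t
  have "2 * Gam (carrier G) (cayley_adj G S) f f x = 1/4 * (\<Sum>s\<in>S. (w s s)\<^sup>2)"
    unfolding Gam_cayley[OF x] sum_distrib_left
    by (intro sum.cong) (auto simp: w_def S_cancel x power2_eq_square algebra_simps)
  \<comment> \<open>For each \<open>s\<close> only the square with \<open>t = s\<close> is
    kept.\<close>
  also have "\<dots> \<le> 1/4 * (\<Sum>s\<in>S. \<Sum>t\<in>S. (w s t)\<^sup>2)"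
    by (intro mult_left_mono sum_mono member_le_sum) (auto simp: S_finite)
  finally show "2 * Gam (carrier G) (cayley_adj G S) f f x \<le> Gam2 (carrier G) (cayley_adj G S) f x"
    by (simp add: Gam2_cayley[OF x] w_def)
qed

lemma curvature_bound_le_2:
  assumes "S \<noteq> {}" and prod: "\<And>s t. \<lbrakk>s \<in> S; t \<in> S\<rbrakk> \<Longrightarrow> s \<otimes> t \<notin> S"
    and K: "curvature_bound (carrier G) (cayley_adj G S) K"
  shows "K \<le> 2"
proof -
  \<comment> \<open>This is the distance from \<open>\<one>\<close> cut off at 2. Off the diagonal
    the mixed difference is 2 - 1 - 1 + 0 = 0, on it 0 - 1 - 1 + 0 = -2, so the diagonal estimate is
    sharp.\<close>
  define f :: "'a \<Rightarrow> real" where "f g = (if g = \<one> then 0 else if g \<in> S then 1 else 2)" for g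
  \<comment> \<open>Otherwise \<open>prod\<close> would exclude the square of \<open>\<one>\<close>,
    which is \<open>\<one>\<close> itself.\<close>
  have one: "\<one> \<notin> S"
    using prod S_involution by metis
  have fS: "f s = 1" if "s \<in> S" for s
    using that one by (auto simp: f_def)
  have neq: "s \<otimes> t \<noteq> \<one>" if "s \<in> S" "t \<in> S" "s \<noteq> t" for s t
    using that S_cancel[of s t] S_carrier by force
  have w: "(f (s \<otimes> (t \<otimes> \<one>)) - f (s \<otimes> \<one>) - f (t \<otimes> \<one>) + f \<one>)\<^sup>2 = (if s = t then 4 else 0)"
    if "s \<in> S" "t \<in> S" for s t
    using that neq[OF that] prod[OF that] fS S_involution[of s]
    by (auto simp: S_carrier f_def)
  have "Gam2 (carrier G) (cayley_adj G S) f \<one> = real (card S)"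
    by (simp add: Gam2_cayley w S_finite)
  moreover have "Gam (carrier G) (cayley_adj G S) f f \<one> = real (card S) / 2"
    by (simp add: Gam_cayley S_carrier fS) (simp add: f_def)
  ultimately have "K * (real (card S) / 2) \<le> real (card S)"
    using K one_closed unfolding curvature_bound_def by metis
  moreover have "card S > 0"
    using assms(1) S_finite by (simp add: card_gt_0_iff)
  ultimately show ?thesis by (simp add: field_simps)
qed

end

text \<open>Conjugation by \<open>p\<close> relabels the swapped points; here \<open>p\<close> is
  its own inverse. This yields closure of the transpositions under conjugation.\<close>

lemma transpose_conj_involution:
  assumes "\<And>x. p (p x) = x"
  shows "p \<circ> transpose a b \<circ> p = transpose (p a) (p b)"
  using assms unfolding fun_eq_iff comp_apply transpose_def by metis

lemma involution_cayley_transpositions: "involution_cayley (sym_group n) (transpositions n)"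
proof -
  interpret group "sym_group n" by (rule sym_group_is_group)
  show ?thesis
  proof
    have carrier: "transpositions n \<subseteq> carrier (sym_group n)"
      by (auto simp: transpositions_def sym_group_def intro!: permutes_swap_id)
    show "finite (transpositions n)"
      using carrier by (rule finite_subset) (simp add: sym_group_def finite_permutations)
    show "s \<in> carrier (sym_group n)" if "s \<in> transpositions n" for s
      using that carrier by blast
    show "s \<otimes>\<^bsub>sym_group n\<^esub> s = \<one>\<^bsub>sym_group n\<^esub>" if "s \<in> transpositions n" for s
      using that by (auto simp: transpositions_def sym_group_def)
    show "t \<otimes>\<^bsub>sym_group n\<^esub> s \<otimes>\<^bsub>sym_group n\<^esub> t \<in> transpositions n"
      if s: "s \<in> transpositions n" and t: "t \<in> transpositions n" for s t
    proof -
      obtain a b where ab: "a \<in> {1..n}" "b \<in> {1..n}" "a \<noteq> b" "s = transpose a b"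
        using s by (auto simp: transpositions_def)
      have t_perm: "t permutes {1..n}"
        using t carrier by (auto simp: sym_group_def)
      have "t (t x) = x" for x
        using t by (auto simp: transpositions_def)
      then have "t \<circ> s \<circ> t = transpose (t a) (t b)"
        unfolding ab by (rule transpose_conj_involution)
      moreover have "t a \<in> {1..n}" "t b \<in> {1..n}" "t a \<noteq> t b"
        using ab t_perm by (simp_all only: permutes_in_image, simp add: inj_eq permutes_inj)
      ultimately show ?thesis
        by (auto simp: transpositions_def sym_group_def)
    qed
  qed
qed

text \<open>Transpositions are odd, while a product of two odd permutations is even.\<close>

lemma transpositions_comp_notin:
  assumes "s \<in> transpositions n" "t \<in> transpositions n"
  shows "s \<circ> t \<notin> transpositions n"
proof -
  have odd: "permutation r \<and> \<not> evenperm r" if "r \<in> transpositions n" for r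
    using that by (auto simp: transpositions_def evenperm_swap permutation_swap_id)
  then have "evenperm (s \<circ> t)"
    using assms by (simp add: evenperm_comp)
  then show ?thesis using odd by blast
qed

theorem theorem12:
  fixes n :: nat
  assumes "n \<ge> 2"
  shows "has_Ric (carrier (sym_group n)) (cayley_adj (sym_group n) (transpositions n)) 2
       \<and> Ric (carrier (sym_group n)) (cayley_adj (sym_group n) (transpositions n)) = 2"
proof -
  interpret involution_cayley "sym_group n" "transpositions n"
    by (rule involution_cayley_transpositions)
  \<comment> \<open>Here \<open>n \<ge> 2\<close> makes the generating set nonempty, as the upper
    bound on the curvature requires.\<close>
  have "transpose 1 2 \<in> transpositions n"
    using assms unfolding transpositions_def by (intro CollectI exI[of _ 1] exI[of _ 2]) auto
  then have "has_Ric (carrier (sym_group n)) (cayley_adj (sym_group n) (transpositions n)) 2"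
    unfolding has_Ric_def
    using curvature_bound_2 curvature_bound_le_2 transpositions_comp_notin
    by (auto simp: sym_group_def)
  then show ?thesis by (simp add: has_Ric_imp_Ric_eq)
qed

end
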